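(* Let $n\ge 1$. The Deodhar ordering $\leq_D$ on $R_n$ is the same as the Pennell–Putcha–Renner ordering $\leq_{PPR}$ on $R_n$; that is, for all $x,y\in R_n$, $x\leq_D y$ if and only if $x\leq_{PPR} y$.
   Context: The rook monoid $R_n$ is the set of $n\times n$ $0$-$1$ matrices with at most one nonzero entry in each row and each column. One-line notation: $x=(x_{ij})\in R_n$ is written $x=(a_1,\dots,a_n)$, where $a_j=0$ if the $j$-th column of $x$ is zero, and $a_j=i$ if $x_{ij}=1$. (So $a_j\in\{0,1,\dots,n\}$ and the nonzero $a_j$ are distinct.) Deodhar ordering. For an integer vector $a=(a_1,\dots,a_k)$, $\widetilde{a}$ is the rearrangement of its entries in non-increasing order. For integer vectors $a,b$ of the same length $k$, $a\leq_c b$ means that for every $j=1,\dots,k$ the $j$-th entry of $\widetilde a$ is $\le$ the $j$-th entry of $\widetilde b$. The $k$-th truncation of $a=(a_1,\dots,a_n)$ is $a(k)=(a_1,\dots,a_k)$. For $v,w\in R_n$ in one-line notation, $v\leq_D w$ if and only if $\widetilde{v(k)}\leq_c\widetilde{w(k)}$ for all $k=1,\dots,n$. Pennell–Putcha–Renner ordering. $\leq_{PPR}$ is the smallest partial order on $R_n$ generated by declaring $x=(a_1,\dots,a_n)\leq y=(b_1,\dots,b_n)$ if either (1) there exists $1\le i\le n$ such that $b_i>a_i$ and $b_j=a_j$ for all $j\ne i$; or (2) there exist $1\le i<j\le n$ such that $b_i=a_j$, $b_j=a_i$, $b_i>b_j$, and $b_k=a_k$ for all $k\notin\{i,j\}$.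 *)

theory Defs
  imports "Jordan_Normal_Form.Matrix"
begin

definition rook_monoid :: "nat \<Rightarrow> int mat set" where
  "rook_monoid n = {x \<in> carrier_mat n n.
     (\<forall>i<n. \<forall>j<n. x $$ (i, j) \<in> {0, 1}) \<and>
     (\<forall>i<n. card {j. j < n \<and> x $$ (i, j) \<noteq> 0} \<le> 1) \<and>
     (\<forall>j<n. card {i. i < n \<and> x $$ (i, j) \<noteq> 0} \<le> 1)}"

(* Rows and columns of a matrix are indexed from 0, as are lists; the entries a_j of the
   one-line notation keep their values in {0,...,n}, hence the shift by one. *)
definition one_line :: "int mat \<Rightarrow> int list" where
  "one_line x = map (\<lambda>j.
     if \<forall>i<dim_row x. x $$ (i, j) = 0 then 0
     else 1 + int (THE i. i < dim_row x \<and> x $$ (i, j) = 1)) [0..<dim_col x]"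

definition noninc :: "int list \<Rightarrow> int list" where
  "noninc a = rev (sort a)"

definition le_c :: "int list \<Rightarrow> int list \<Rightarrow> bool" where
  "le_c a b \<longleftrightarrow> length a = length b \<and> (\<forall>j<length a. noninc a ! j \<le> noninc b ! j)"

definition deodhar_le :: "nat \<Rightarrow> int mat \<Rightarrow> int mat \<Rightarrow> bool" where
  "deodhar_le n v w \<longleftrightarrow>
     (\<forall>k\<in>{1..n}. le_c (noninc (take k (one_line v))) (noninc (take k (one_line w))))"

definition ppr_increase :: "int list \<Rightarrow> int list \<Rightarrow> bool" where
  "ppr_increase a b \<longleftrightarrow> length a = length b \<and>
     (\<exists>i<length a. b ! i > a ! i \<and> (\<forall>j<length a. j \<noteq> i \<longrightarrow> b ! j = a ! j))"

definition ppr_swap :: "int list \<Rightarrow> int list \<Rightarrow> bool" where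
  "ppr_swap a b \<longleftrightarrow> length a = length b \<and>
     (\<exists>i j. i < j \<and> j < length a \<and> b ! i = a ! j \<and> b ! j = a ! i \<and> b ! i > b ! j \<and>
        (\<forall>k<length a. k \<notin> {i, j} \<longrightarrow> b ! k = a ! k))"

definition ppr_gen :: "nat \<Rightarrow> (int mat \<times> int mat) set" where
  "ppr_gen n = {(x, y). x \<in> rook_monoid n \<and> y \<in> rook_monoid n \<and>
     (ppr_increase (one_line x) (one_line y) \<or> ppr_swap (one_line x) (one_line y))}"

(* The family intersected is nonempty and the intersection is itself a partial order
   containing the generators: see ppr_order_partial_order and ppr_gen_subset below. *)
definition ppr_order :: "nat \<Rightarrow> (int mat \<times> int mat) set" where
  "ppr_order n = \<Inter>{r. partial_order_on (rook_monoid n) r \<and> ppr_gen n \<subseteq> r}"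

definition ppr_le :: "nat \<Rightarrow> int mat \<Rightarrow> int mat \<Rightarrow> bool" where
  "ppr_le n x y \<longleftrightarrow> (x, y) \<in> ppr_order n"

lemma length_one_line: "x \<in> rook_monoid n \<Longrightarrow> length (one_line x) = n"
  by (auto simp: rook_monoid_def one_line_def)

definition ppr_weight :: "int list \<Rightarrow> int" where
  "ppr_weight a = (\<Sum>k<length a. int (length a - k) * a ! k)"

lemma ppr_weight_increase:
  assumes "ppr_increase a b" shows "ppr_weight a < ppr_weight b"
proof -
  from assms obtain i where i: "length a = length b" "i < length a" "b ! i > a ! i"
    and eq: "\<And>j. j < length a \<Longrightarrow> j \<noteq> i \<Longrightarrow> b ! j = a ! j"
    unfolding ppr_increase_def by blast
  have "(\<Sum>k<length a. int (length a - k) * a ! k) < (\<Sum>k<length a. int (length a - k) * b ! k)"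
  proof (rule sum_strict_mono_ex1)
    show "\<forall>k\<in>{..<length a}. int (length a - k) * a ! k \<le> int (length a - k) * b ! k"
      using i eq by (metis lessThan_iff linorder_not_less mult_left_mono nle_le of_nat_0_le_iff)
    show "\<exists>k\<in>{..<length a}. int (length a - k) * a ! k < int (length a - k) * b ! k"
      using i by (intro bexI[of _ i]) auto
  qed simp
  then show ?thesis by (simp add: ppr_weight_def i(1))
qed

lemma ppr_weight_swap:
  assumes "ppr_swap a b" shows "ppr_weight a < ppr_weight b"
proof -
  from assms obtain i j where l: "length a = length b" and ij: "i < j" "j < length a"
    "b ! i = a ! j" "b ! j = a ! i" "b ! i > b ! j"
    and eq: "\<And>k. k < length a \<Longrightarrow> k \<notin> {i, j} \<Longrightarrow> b ! k = a ! k"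
    unfolding ppr_swap_def by blast
  let ?n = "length a"
  let ?f = "\<lambda>k. int (?n - k) * (b ! k - a ! k)"
  have "ppr_weight b - ppr_weight a = (\<Sum>k<?n. ?f k)"
    by (simp add: ppr_weight_def l sum_subtractf right_diff_distrib)
  also have "\<dots> = (\<Sum>k\<in>{i, j}. ?f k)"
    using ij eq by (intro sum.mono_neutral_right) auto
  also have "\<dots> = (int (?n - i) - int (?n - j)) * (b ! i - b ! j)"
    using ij by (simp add: algebra_simps)
  also have "\<dots> > 0" using ij by (intro mult_pos_pos) auto
  finally show ?thesis by simp
qed

lemma ppr_gen_in_partial_order:
  "\<exists>r. partial_order_on (rook_monoid n) r \<and> ppr_gen n \<subseteq> r"
proof (intro exI conjI)
  let ?r = "{(x, y). x \<in> rook_monoid n \<and> y \<in> rook_monoid n \<and>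
    (x = y \<or> ppr_weight (one_line x) < ppr_weight (one_line y))}"
  show "partial_order_on (rook_monoid n) ?r"
    by (auto simp: partial_order_on_def preorder_on_def refl_on_def trans_def antisym_def)
  show "ppr_gen n \<subseteq> ?r"
    by (auto simp: ppr_gen_def ppr_weight_increase ppr_weight_swap)
qed

lemma ppr_order_partial_order: "partial_order_on (rook_monoid n) (ppr_order n)"
proof -
  let ?F = "{r. partial_order_on (rook_monoid n) r \<and> ppr_gen n \<subseteq> r}"
  obtain r where r: "r \<in> ?F" using ppr_gen_in_partial_order by blast
  have sub: "ppr_order n \<subseteq> r" using r unfolding ppr_order_def by blast
  have "ppr_order n \<subseteq> rook_monoid n \<times> rook_monoid n"
    using sub r by (auto simp: partial_order_on_def preorder_on_def refl_on_def)
  moreover have "refl_on (rook_monoid n) (ppr_order n)"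
    using calculation
    by (auto simp: ppr_order_def partial_order_on_def preorder_on_def refl_on_def)
  moreover have "trans (ppr_order n)"
    unfolding ppr_order_def partial_order_on_def preorder_on_def
    by (rule transI) (blast dest: transD)
  moreover have "antisym r" using r by (simp add: partial_order_on_def)
  then have "antisym (ppr_order n)" using sub by (rule antisym_subset[rotated])
  ultimately show ?thesis by (simp add: partial_order_on_def preorder_on_def)
qed

lemma ppr_gen_subset: "ppr_gen n \<subseteq> ppr_order n"
  unfolding ppr_order_def by blast

end

theory Submission
  imports Defs
begin

text \<open>
  Comparing the sorted truncations of two words entry by entry amounts to comparing, for every
  prefix length \<open>k\<close> and threshold \<open>t\<close>, the number of entries \<open>\<ge> t\<close> among the first \<open>k\<close>
  (\<open>deodhar_le_iff_rank\<close>). In this form both generating moves visibly go up in the Deodhar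
  preorder, and therefore so does everything they generate.

  For the converse let \<open>a \<noteq> b\<close> be the words of two rook matrices with \<open>a\<close> below \<open>b\<close>. It suffices
  to find one generating move from \<open>a\<close> to some \<open>a'\<close> that is still below \<open>b\<close>, since every move
  increases \<open>ppr_weight\<close>, which is bounded. At the first position \<open>i\<close> where the words
  differ, necessarily \<open>a ! i < b ! i\<close>. If some later entry of \<open>a\<close> lies in the interval
  from \<open>a ! i\<close> (excluded) to \<open>b ! i\<close> (included), swap \<open>a ! i\<close> with the first such entry;
  otherwise the value \<open>b ! i\<close> is free in \<open>a\<close>, and \<open>a ! i\<close> can be raised to it.
  In both cases the prefixes whose counts grow contain no entry of \<open>a\<close> in that interval after
  position \<open>i\<close>. For thresholds in the interval, the entries that \<open>a'\<close> has above \<open>b ! i\<close> are then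
  dominated by those of \<open>b\<close> by hypothesis, and those up to \<open>b ! i\<close> sit at positions \<open>\<le> i\<close>, where
  \<open>b\<close> has at least as many (\<open>rank_raise_le\<close>).
\<close>

section \<open>Counting large entries in a prefix\<close>

definition rank :: "int list \<Rightarrow> nat \<Rightarrow> int \<Rightarrow> nat" where
  "rank a k t = length (filter (\<lambda>v. t \<le> v) (take k a))"

lemma rank_eq_card:
  assumes "k \<le> length a"
  shows "rank a k t = card {p. p < k \<and> t \<le> a ! p}"
  using assms unfolding rank_def length_filter_conv_card
  by (intro arg_cong[where f = card]) auto

lemma rank_mono:
  assumes "k \<le> length a" "k \<le> length b" "\<And>p. p < k \<Longrightarrow> a ! p \<le> b ! p"
  shows "rank a k t \<le> rank b k t"
  unfolding rank_eq_card[OF assms(1)] rank_eq_card[OF assms(2)]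
  by (rule card_mono) (use assms(3) order_trans in auto)

lemma rank_cong:
  assumes "k \<le> length a" "k \<le> length b" "\<And>p. p < k \<Longrightarrow> a ! p = b ! p"
  shows "rank a k t = rank b k t"
  by (rule antisym; rule rank_mono) (use assms in auto)

text \<open>Both positions lie in the prefix, so the swap only permutes its entries.\<close>

lemma rank_swap:
  assumes "i < k" "j < k" "k \<le> length a"
  shows "rank (a[i := a ! j, j := a ! i]) k t = rank a k t"
proof -
  have "take k (a[i := a ! j, j := a ! i])
      = (take k a)[i := take k a ! j, j := take k a ! i]"
    using assms by (simp add: take_update_swap)
  also have "mset \<dots> = mset (take k a)"
    using assms by (intro mset_swap) auto
  finally show ?thesis
    unfolding rank_def by (metis mset_filter size_mset)
qed

text \<open>
  In a non-increasing list the entries \<open>\<ge> t\<close> form an initial segment, so the \<open>j\<close>-th entry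
  is one of them exactly when there are more than \<open>j\<close> of them.
\<close>

lemma noninc_nth_ge_iff:
  assumes "j < length a"
  shows "t \<le> noninc a ! j \<longleftrightarrow> j < length (filter (\<lambda>v. t \<le> v) a)"
proof -
  have sorted_case: "t \<le> c ! j \<longleftrightarrow> j < length (filter (\<lambda>v. t \<le> v) c)"
    if "sorted_wrt (\<ge>) c" "j < length c" for c :: "int list" and j
    using that
  proof (induction c arbitrary: j)
    case (Cons x xs)
    show ?case
    proof (cases "t \<le> x")
      case True
      then show ?thesis using Cons by (cases j) auto
    next
      case False
      then have "\<forall>v\<in>set (x # xs). \<not> t \<le> v" using Cons.prems(1) by fastforce
      then show ?thesis using Cons.prems(2) by (metis filter_False length_0_conv not_less0 nth_mem)
    qed
  qed simp
  have "sorted_wrt (\<ge>) (noninc a)"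
    unfolding noninc_def sorted_wrt_rev by simp
  moreover have "length (filter (\<lambda>v. t \<le> v) (noninc a)) = length (filter (\<lambda>v. t \<le> v) a)"
    unfolding noninc_def by (metis mset_filter mset_rev mset_sort size_mset)
  ultimately show ?thesis
    using sorted_case[of "noninc a" j] assms by (simp add: noninc_def)
qed

lemma le_c_iff_counts:
  assumes "length a = length b"
  shows "le_c a b \<longleftrightarrow>
    (\<forall>t. length (filter (\<lambda>v. t \<le> v) a) \<le> length (filter (\<lambda>v. t \<le> v) b))"
    (is "_ \<longleftrightarrow> (\<forall>t. ?N t a \<le> ?N t b)")
proof
  assume le: "le_c a b"
  show "\<forall>t. ?N t a \<le> ?N t b"
  proof
    fix t
    show "?N t a \<le> ?N t b"
    proof (cases "?N t a")
      case (Suc j)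
      then have j: "j < length a"
        by (metis length_filter_le Suc_le_lessD)
      then have "t \<le> noninc a ! j"
        using Suc by (simp add: noninc_nth_ge_iff)
      also have "\<dots> \<le> noninc b ! j"
        using le j by (simp add: le_c_def)
      finally have "j < ?N t b"
        using j assms by (simp add: noninc_nth_ge_iff)
      then show ?thesis using Suc by simp
    qed simp
  qed
next
  assume N: "\<forall>t. ?N t a \<le> ?N t b"
  have "noninc a ! j \<le> noninc b ! j" if j: "j < length a" for j
  proof -
    have "j < ?N (noninc a ! j) a"
      using noninc_nth_ge_iff[OF j, of "noninc a ! j"] by simp
    also have "\<dots> \<le> ?N (noninc a ! j) b" using N by blast
    finally show ?thesis
      using noninc_nth_ge_iff[of j b] j assms by simp
  qed
  then show "le_c a b" using assms by (simp add: le_c_def)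
qed

lemma deodhar_le_iff_rank:
  assumes "x \<in> rook_monoid n" "y \<in> rook_monoid n"
  shows "deodhar_le n x y \<longleftrightarrow>
    (\<forall>k\<le>n. \<forall>t. rank (one_line x) k t \<le> rank (one_line y) k t)"
proof -
  have idem: "noninc (noninc a) = noninc a" for a
    unfolding noninc_def by (metis properties_for_sort mset_rev sorted_sort mset_sort)
  have "le_c (noninc (take k (one_line x))) (noninc (take k (one_line y)))
      \<longleftrightarrow> (\<forall>t. rank (one_line x) k t \<le> rank (one_line y) k t)" for k
  proof -
    have "length (take k (one_line x)) = length (take k (one_line y))"
      using assms by (simp add: length_one_line)
    from le_c_iff_counts[OF this] show ?thesis
      unfolding rank_def le_c_def idem by (simp add: noninc_def)
  qed
  moreover have "(\<forall>k\<in>{1..n}. P k) \<longleftrightarrow> (\<forall>k\<le>n. P k)" if "P 0" for P :: "nat \<Rightarrow> bool"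
    using that by (metis atLeastAtMost_iff less_one not_le)
  \<comment> \<open>The order quantifies over \<open>k \<ge> 1\<close>; for \<open>k = 0\<close> both counts are zero.\<close>
  ultimately show ?thesis
    unfolding deodhar_le_def by (simp add: rank_def)
qed

section \<open>Rook matrices as words\<close>

definition rook_word :: "nat \<Rightarrow> int list \<Rightarrow> bool" where
  "rook_word n a \<longleftrightarrow> length a = n \<and> set a \<subseteq> {0..int n} \<and>
     (\<forall>p<n. \<forall>q<n. a ! p = a ! q \<longrightarrow> a ! p \<noteq> 0 \<longrightarrow> p = q)"

definition matrix_of :: "nat \<Rightarrow> int list \<Rightarrow> int mat" where
  "matrix_of n a = mat n n (\<lambda>(i, j). if a ! j = 1 + int i then 1 else 0)"

text \<open>
  A column is either zero or a unit vector; the at-most-one condition on columns is what makes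
  the definite description in \<open>one_line\<close> meaningful.
\<close>

lemma one_line_cases:
  assumes x: "x \<in> rook_monoid n" and j: "j < n"
  obtains "one_line x ! j = 0" "\<And>i. i < n \<Longrightarrow> x $$ (i, j) = 0"
  | i where "i < n" "one_line x ! j = 1 + int i"
      "\<And>i'. i' < n \<Longrightarrow> x $$ (i', j) = (if i' = i then 1 else 0)"
proof (cases "\<forall>i<n. x $$ (i, j) = 0")
  case True
  then show ?thesis using that(1) x j by (auto simp: one_line_def rook_monoid_def)
next
  case False
  then obtain i where i: "i < n" "x $$ (i, j) \<noteq> 0" by blast
  have entry: "x $$ (i', j) = 0 \<or> x $$ (i', j) = 1" if "i' < n" for i'
    using x j that by (auto simp: rook_monoid_def)
  have "card {i. i < n \<and> x $$ (i, j) \<noteq> 0} \<le> Suc 0"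
    using x j by (auto simp: rook_monoid_def)
  then have unique: "i' = i" if "i' < n" "x $$ (i', j) \<noteq> 0" for i'
    using i that by (subst (asm) card_le_Suc0_iff_eq) auto
  have one: "x $$ (i, j) = 1" using entry[OF i(1)] i(2) by blast
  have "(THE i'. i' < n \<and> x $$ (i', j) = 1) = i"
  proof (rule the_equality)
    show "i < n \<and> x $$ (i, j) = 1" using i(1) one by blast
    show "i' = i" if "i' < n \<and> x $$ (i', j) = 1" for i'
      using that unique[of i'] by simp
  qed
  then have "one_line x ! j = 1 + int i"
    using x j i unfolding one_line_def rook_monoid_def by auto
  moreover have "x $$ (i', j) = (if i' = i then 1 else 0)" if "i' < n" for i'
    using one unique[OF that] by (cases "i' = i") auto
  ultimately show ?thesis using that(2)[OF i(1)] by blast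
qed

lemma one_line_nth_iff:
  assumes "x \<in> rook_monoid n" "i < n" "j < n"
  shows "one_line x ! j = 1 + int i \<longleftrightarrow> x $$ (i, j) = 1"
  by (rule one_line_cases[OF assms(1,3)]) (use assms(2) in auto)

lemma matrix_of_one_line:
  assumes "x \<in> rook_monoid n"
  shows "matrix_of n (one_line x) = x"
proof (rule eq_matI)
  fix i j assume "i < dim_row x" "j < dim_col x"
  then have ij: "i < n" "j < n" using assms by (auto simp: rook_monoid_def)
  moreover have "x $$ (i, j) \<in> {0, 1}" using assms ij by (auto simp: rook_monoid_def)
  ultimately show "matrix_of n (one_line x) $$ (i, j) = x $$ (i, j)"
    using one_line_nth_iff[OF assms ij] by (auto simp: matrix_of_def)
qed (use assms in \<open>auto simp: matrix_of_def rook_monoid_def\<close>)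

lemma rook_word_one_line:
  assumes x: "x \<in> rook_monoid n"
  shows "rook_word n (one_line x)"
proof -
  have len: "length (one_line x) = n" by (rule length_one_line[OF x])
  have "one_line x ! j \<in> {0..int n}" if "j < n" for j
    by (rule one_line_cases[OF x that]) auto
  then have "set (one_line x) \<subseteq> {0..int n}"
    using len by (metis in_set_conv_nth subsetI)
  moreover have "p = q"
    if pq: "p < n" "q < n" and eq: "one_line x ! p = one_line x ! q" and nz: "one_line x ! p \<noteq> 0"
    for p q
  proof -
    obtain i where i: "i < n" "one_line x ! p = 1 + int i"
      using nz by (auto intro: one_line_cases[OF x pq(1)])
    then have "x $$ (i, p) = 1" "x $$ (i, q) = 1"
      using one_line_nth_iff[OF x i(1) pq(1)] one_line_nth_iff[OF x i(1) pq(2)] eq by metis+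
    moreover have "card {j. j < n \<and> x $$ (i, j) \<noteq> 0} \<le> Suc 0"
      using x i by (auto simp: rook_monoid_def)
    ultimately show "p = q"
      using pq by (subst (asm) card_le_Suc0_iff_eq) auto
  qed
  ultimately show ?thesis using len by (simp add: rook_word_def)
qed

text \<open>
  Together with \<open>matrix_of_one_line\<close> and \<open>rook_word_one_line\<close> this identifies rook matrices
  with their words, so that a move made on words can be carried out on matrices.
\<close>

lemma matrix_of_rook_word:
  assumes a: "rook_word n a"
  shows "matrix_of n a \<in> rook_monoid n" and "one_line (matrix_of n a) = a"
proof -
  have "card {j. j < n \<and> matrix_of n a $$ (i, j) \<noteq> 0} \<le> Suc 0" if "i < n" for i
    using a that by (subst card_le_Suc0_iff_eq) (auto simp: matrix_of_def rook_word_def split: if_splits)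
  moreover have "card {i. i < n \<and> matrix_of n a $$ (i, j) \<noteq> 0} \<le> Suc 0" if "j < n" for j
    using that by (subst card_le_Suc0_iff_eq) (auto simp: matrix_of_def split: if_splits)
  ultimately show R: "matrix_of n a \<in> rook_monoid n"
    by (auto simp: rook_monoid_def) (auto simp: matrix_of_def)
  show "one_line (matrix_of n a) = a"
  proof (rule nth_equalityI)
    show "length (one_line (matrix_of n a)) = length a"
      using R a by (simp add: length_one_line rook_word_def)
    fix j assume "j < length (one_line (matrix_of n a))"
    then have j: "j < n" using R by (simp add: length_one_line)
    have bound: "0 \<le> a ! j" "a ! j \<le> int n"
      using a j by (auto simp: rook_word_def subset_iff)
    show "one_line (matrix_of n a) ! j = a ! j"
    proof (cases "a ! j = 0")
      case True
      then have "matrix_of n a $$ (i, j) = 0" if "i < n" for i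
        using j that by (simp add: matrix_of_def)
      then show ?thesis using True R j by (auto simp: one_line_def rook_monoid_def)
    next
      case False
      define i where "i = nat (a ! j - 1)"
      have i: "i < n" "a ! j = 1 + int i" using bound False by (auto simp: i_def)
      then have "matrix_of n a $$ (i, j) = 1" using j by (simp add: matrix_of_def)
      then show ?thesis using one_line_nth_iff[OF R i(1) j] i(2) by simp
    qed
  qed
qed

section \<open>Moving up one generator\<close>

lemma ppr_increase_rank_le:
  assumes "ppr_increase a b" "k \<le> length a"
  shows "rank a k t \<le> rank b k t"
proof (rule rank_mono)
  show "a ! p \<le> b ! p" if "p < k" for p
    using assms that unfolding ppr_increase_def
    by (metis less_le_trans order_less_imp_le order_refl)
qed (use assms in \<open>auto simp: ppr_increase_def\<close>)

text \<open>
  A prefix ending before the second swapped position sees only an entry being raised; a longer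
  prefix contains both swapped entries, and its counts do not change.
\<close>

lemma ppr_swap_rank_le:
  assumes "ppr_swap a b" "k \<le> length a"
  shows "rank a k t \<le> rank b k t"
proof -
  obtain i j where ij: "i < j" "j < length a" "length a = length b"
      "b ! i = a ! j" "b ! j = a ! i" "b ! i > b ! j"
    and rest: "\<And>p. p < length a \<Longrightarrow> p \<noteq> i \<Longrightarrow> p \<noteq> j \<Longrightarrow> b ! p = a ! p"
    using assms(1) unfolding ppr_swap_def by blast
  show ?thesis
  proof (cases "j < k")
    case True
    have "b = a[i := a ! j, j := a ! i]"
    proof (rule nth_equalityI)
      show "length b = length (a[i := a ! j, j := a ! i])" using ij(3) by simp
      fix p assume "p < length b"
      then have "p < length a" using ij(3) by simp
      then show "b ! p = a[i := a ! j, j := a ! i] ! p"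
        using ij(1,2,4,5) rest[of p] by (cases "p = i"; cases "p = j") simp_all
    qed
    then show ?thesis using rank_swap[of i k j a t] True ij(1) assms(2) by simp
  next
    case False
    show ?thesis
    proof (rule rank_mono)
      show "a ! p \<le> b ! p" if "p < k" for p
      proof (cases "p = i")
        case True
        then show ?thesis using ij(4-6) by simp
      next
        case neq: False
        then show ?thesis using that False assms(2) rest[of p] by simp
      qed
    qed (use assms(2) ij(3) in auto)
  qed
qed

text \<open>
  Only thresholds \<open>t\<close> with \<open>a ! i < t \<le> v\<close> are affected by the update. For them no entry
  strictly between positions \<open>i\<close> and \<open>k\<close> has a value from \<open>t\<close> to \<open>b ! i\<close>. So each entry counted
  after the update is either above \<open>b ! i\<close>, and these are controlled by the hypothesis at
  threshold \<open>b ! i + 1\<close>, or at a position \<open>\<le> i\<close> where \<open>b\<close> also has a value from \<open>t\<close> to \<open>b ! i\<close>.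
  The room for the new entry comes from position \<open>i\<close> of \<open>b\<close> itself.
\<close>

lemma rank_raise_le:
  assumes k: "i < k" "k \<le> length a" "k \<le> length b"
    and prefix: "\<And>p. p < i \<Longrightarrow> a ! p = b ! p"
    and v: "v \<le> b ! i"
    and gap: "\<And>p. i < p \<Longrightarrow> p < k \<Longrightarrow> a ! p \<le> a ! i \<or> b ! i < a ! p"
    and le: "\<And>s. rank a k s \<le> rank b k s"
  shows "rank (a[i := v]) k t \<le> rank b k t"
proof (cases "a ! i < t \<and> t \<le> v")
  case True
  let ?high = "{p. p < k \<and> b ! i + 1 \<le> a ! p}"
  let ?low = "{p. p \<le> i \<and> t \<le> b ! p \<and> b ! p \<le> b ! i}"
  let ?high' = "{p. p < k \<and> b ! i + 1 \<le> b ! p}"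
  have "rank (a[i := v]) k t = card {p. p < k \<and> t \<le> a[i := v] ! p}"
    using k by (simp add: rank_eq_card)
  also have "\<dots> \<le> card (?high \<union> ?low)"
  proof (rule card_mono)
    show "{p. p < k \<and> t \<le> a[i := v] ! p} \<subseteq> ?high \<union> ?low"
    proof
      fix p assume "p \<in> {p. p < k \<and> t \<le> a[i := v] ! p}"
      then have p: "p < k" "t \<le> a[i := v] ! p" by auto
      consider "p < i" | "p = i" | "i < p" by linarith
      then show "p \<in> ?high \<union> ?low"
      proof cases
        case 1
        then show ?thesis using p prefix[of p] by auto
      next
        case 2
        then show ?thesis using True v by auto
      next
        case 3
        then show ?thesis using p gap[of p] True by auto
      qed
    qed
  qed simp
  also have "\<dots> \<le> card ?high + card ?low" by (rule card_Un_le)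
  also have "card ?high = rank a k (b ! i + 1)" using k by (simp add: rank_eq_card)
  also have "rank a k (b ! i + 1) + card ?low \<le> rank b k (b ! i + 1) + card ?low"
    using le by simp
  also have "\<dots> = card ?high' + card ?low" using k by (simp add: rank_eq_card)
  also have "\<dots> = card (?high' \<union> ?low)" by (rule card_Un_disjoint[symmetric]) auto
  also have "\<dots> \<le> card {p. p < k \<and> t \<le> b ! p}"
    by (rule card_mono) (use k True v in auto)
  also have "\<dots> = rank b k t" using k by (simp add: rank_eq_card)
  finally show ?thesis .
next
  case False
  have "rank (a[i := v]) k t \<le> rank a k t"
    using k False by (auto simp: rank_eq_card nth_list_update intro!: card_mono split: if_splits)
  then show ?thesis using le order_trans by blast
qed

text \<open>
  Count the entries \<open>\<ge> a ! i\<close> in the prefix of length \<open>i + 1\<close>: up to position \<open>i\<close> the words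
  agree, so \<open>b\<close> can only keep up if \<open>b ! i\<close> is counted as well.
\<close>

lemma first_difference_less:
  assumes i: "i < length a" "length a = length b"
    and prefix: "\<And>p. p < i \<Longrightarrow> a ! p = b ! p" and neq: "a ! i \<noteq> b ! i"
    and le: "\<And>s. rank a (Suc i) s \<le> rank b (Suc i) s"
  shows "a ! i < b ! i"
proof -
  have "rank c (Suc i) s = rank c i s + (if s \<le> c ! i then 1 else 0)" if "i < length c" for c s
    using that by (simp add: rank_def take_Suc_conv_app_nth)
  moreover have "rank a i (a ! i) = rank b i (a ! i)"
    by (rule rank_cong) (use i prefix in auto)
  ultimately have "a ! i \<le> b ! i"
    using le[of "a ! i"] i by (auto split: if_splits)
  then show ?thesis using neq by simp
qed

text \<open>
  The heart of the converse. Swapping with the \<^emph>\<open>first\<close> later entry in the interval is what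
  makes \<open>rank_raise_le\<close> applicable: on every prefix that contains position \<open>i\<close> but not \<open>j\<close>,
  the swap is a raise of \<open>a ! i\<close> with no other entry in the interval.
\<close>

lemma rank_le_step:
  assumes a: "rook_word n a" and b: "rook_word n b" and "a \<noteq> b"
    and le: "\<And>k t. k \<le> n \<Longrightarrow> rank a k t \<le> rank b k t"
  obtains a' where "rook_word n a'" "ppr_increase a a' \<or> ppr_swap a a'"
    "\<And>k t. k \<le> n \<Longrightarrow> rank a' k t \<le> rank b k t"
proof -
  have len: "length a = n" "length b = n" using a b by (auto simp: rook_word_def)
  define i where "i = (LEAST i. i < n \<and> a ! i \<noteq> b ! i)"
  have "\<exists>i. i < n \<and> a ! i \<noteq> b ! i" using \<open>a \<noteq> b\<close> len nth_equalityI by metis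
  from LeastI_ex[OF this] have i: "i < n" "a ! i \<noteq> b ! i" unfolding i_def by auto
  have prefix: "a ! p = b ! p" if "p < i" for p
    using not_less_Least[OF that[unfolded i_def]] that i(1) by simp
  have lt: "a ! i < b ! i"
    using first_difference_less[of i a b] i len prefix le by simp
  have range: "0 \<le> a ! p" "a ! p \<le> int n" "b ! p \<le> int n" if "p < n" for p
    using a b that len by (auto simp: rook_word_def subset_iff)
  have inj: "p = q" if "p < n" "q < n" "a ! p = a ! q" "a ! p \<noteq> 0" for p q
    using a that unfolding rook_word_def by blast
  show thesis
  proof (cases "\<exists>j. i < j \<and> j < n \<and> a ! i < a ! j \<and> a ! j \<le> b ! i")
    case True
    define j where "j = (LEAST j. i < j \<and> j < n \<and> a ! i < a ! j \<and> a ! j \<le> b ! i)"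
    have j: "i < j" "j < n" "a ! i < a ! j" "a ! j \<le> b ! i"
      using LeastI_ex[OF True] unfolding j_def by auto
    have gap: "a ! p \<le> a ! i \<or> b ! i < a ! p" if "i < p" "p < j" for p
      using not_less_Least[OF that(2)[unfolded j_def]] that j by auto
    define a' where "a' = a[i := a ! j, j := a ! i]"
    have nth: "a' ! p = (if p = i then a ! j else if p = j then a ! i else a ! p)" if "p < n" for p
      using that j i len by (auto simp: a'_def nth_list_update)
    have len': "length a' = n" by (simp add: a'_def len)
    have "set a' = set a"
      unfolding a'_def using i j len by (intro set_swap) auto
    moreover have "p = q" if pq: "p < n" "q < n" and "a' ! p = a' ! q" "a' ! p \<noteq> 0" for p q
      using that inj i j by (simp add: nth split: if_splits)
    ultimately have "rook_word n a'" using a len' by (simp add: rook_word_def)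
    moreover have "ppr_swap a a'"
      unfolding ppr_swap_def using i j nth len len' by (intro conjI exI[of _ i] exI[of _ j]) auto
    moreover have "rank a' k t \<le> rank b k t" if k: "k \<le> n" for k t
    proof -
      consider "k \<le> i" | "i < k" "k \<le> j" | "j < k" by linarith
      then show ?thesis
      proof cases
        case 1
        then have "rank a' k t = rank a k t"
          using k j len len' by (intro rank_cong) (auto simp: nth)
        then show ?thesis using le[OF k] by simp
      next
        case 2
        then have "rank a' k t = rank (a[i := a ! j]) k t"
          using k len len' by (intro rank_cong) (auto simp: nth nth_list_update)
        also have "\<dots> \<le> rank b k t"
          using 2 k len prefix j gap le[OF k] by (intro rank_raise_le) auto
        finally show ?thesis .
      next
        case 3
        then show ?thesis
          using rank_swap[of i k j a t] le[OF k] k j len by (simp add: a'_def)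
      qed
    qed
    ultimately show thesis using that by blast
  next
    case False
    define a' where "a' = a[i := b ! i]"
    have nth: "a' ! p = (if p = i then b ! i else a ! p)" if "p < n" for p
      using that len by (auto simp: a'_def nth_list_update)
    have len': "length a' = n" by (simp add: a'_def len)
    have "0 < b ! i" using lt range[OF i(1)] by linarith
    \<comment> \<open>Before \<open>i\<close> the words agree and the nonzero value \<open>b ! i\<close> occurs only once in \<open>b\<close>;
      after \<open>i\<close> it is excluded by the case assumption.\<close>
    have fresh: "a ! p \<noteq> b ! i" if "p < n" for p
    proof (cases "p < i")
      case True
      then show ?thesis
        using b prefix[of p] i that \<open>0 < b ! i\<close> unfolding rook_word_def by (metis less_irrefl)
    next
      case pi: False
      show ?thesis
      proof (cases "p = i")
        case True
        then show ?thesis using lt by simp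
      next
        case neq: False
        then have "i < p" using pi by simp
        then have "\<not> (a ! i < a ! p \<and> a ! p \<le> b ! i)" using False that by blast
        then show ?thesis using lt by auto
      qed
    qed
    have "set a' \<subseteq> {0..int n}"
      using a range(3)[OF i(1)] \<open>0 < b ! i\<close> set_update_subset_insert[of a i "b ! i"]
      unfolding a'_def rook_word_def by fastforce
    moreover have "p = q" if pq: "p < n" "q < n" and "a' ! p = a' ! q" "a' ! p \<noteq> 0" for p q
      using that inj[OF pq] fresh[OF pq(1)] fresh[OF pq(2)]
      by (simp add: nth split: if_splits)
    ultimately have "rook_word n a'" using len' by (simp add: rook_word_def)
    moreover have "ppr_increase a a'"
      unfolding ppr_increase_def using i lt nth len len' by auto
    moreover have "rank a' k t \<le> rank b k t" if k: "k \<le> n" for k t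
    proof (cases "i < k")
      case True
      have gap: "a ! p \<le> a ! i \<or> b ! i < a ! p" if "i < p" "p < k" for p
        using False that k by (meson less_le_trans not_less)
      show ?thesis unfolding a'_def
        by (rule rank_raise_le) (use True k len prefix gap le[OF k] in auto)
    next
      case ki: False
      then have "rank a' k t = rank a k t"
        using k len len' by (intro rank_cong) (auto simp: nth)
      then show ?thesis using le[OF k] by simp
    qed
    ultimately show thesis using that by blast
  qed
qed

section \<open>The two orders coincide\<close>

lemma ppr_weight_le:
  assumes "rook_word n a"
  shows "ppr_weight a \<le> int n * (int n * int n)"
proof -
  have len: "length a = n" using assms by (simp add: rook_word_def)
  have "ppr_weight a \<le> (\<Sum>k<n. int n * int n)"
    unfolding ppr_weight_def len
  proof (rule sum_mono)
    fix k assume "k \<in> {..<n}"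
    then have "0 \<le> a ! k" "a ! k \<le> int n"
      using assms by (auto simp: rook_word_def subset_iff)
    then show "int (n - k) * a ! k \<le> int n * int n"
      by (intro mult_mono) auto
  qed
  then show ?thesis by simp
qed

lemma ppr_le_refl:
  assumes "x \<in> rook_monoid n"
  shows "ppr_le n x x"
  using ppr_order_partial_order[of n] assms
  by (auto simp: ppr_le_def partial_order_on_def preorder_on_def refl_on_def)

lemma ppr_le_trans: "ppr_le n x y \<Longrightarrow> ppr_le n y z \<Longrightarrow> ppr_le n x z"
  using ppr_order_partial_order[of n]
  unfolding ppr_le_def partial_order_on_def preorder_on_def by (blast dest: transD)

lemma rank_le_imp_ppr_le:
  assumes "rook_word n a" and b: "rook_word n b"
    and "\<And>k t. k \<le> n \<Longrightarrow> rank a k t \<le> rank b k t"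
  shows "ppr_le n (matrix_of n a) (matrix_of n b)"
  using assms(1,3)
proof (induction "nat (int n * (int n * int n) - ppr_weight a)" arbitrary: a rule: less_induct)
  case less
  show ?case
  proof (cases "a = b")
    case True
    then show ?thesis using b matrix_of_rook_word(1) ppr_le_refl by blast
  next
    case False
    obtain a' where a': "rook_word n a'" and gen: "ppr_increase a a' \<or> ppr_swap a a'"
      and le: "\<And>k t. k \<le> n \<Longrightarrow> rank a' k t \<le> rank b k t"
      using rank_le_step[OF less.prems(1) b False less.prems(2)] by blast
    have "ppr_weight a < ppr_weight a'"
      using gen ppr_weight_increase ppr_weight_swap by blast
    then have "ppr_le n (matrix_of n a') (matrix_of n b)"
      using less.hyps[OF _ a' le] ppr_weight_le[OF a'] by simp
    moreover have "(matrix_of n a, matrix_of n a') \<in> ppr_gen n"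
      using gen matrix_of_rook_word[OF a'] matrix_of_rook_word[OF less.prems(1)]
      by (simp add: ppr_gen_def)
    ultimately show ?thesis
      using ppr_gen_subset ppr_le_trans unfolding ppr_le_def by blast
  qed
qed

text \<open>
  Cutting the Pennell--Putcha--Renner order down to the pairs comparable in the Deodhar preorder
  leaves a partial order that still contains all generators, so by minimality nothing was removed.
  Antisymmetry is inherited from the Pennell--Putcha--Renner order.
\<close>

lemma ppr_le_imp_deodhar_le:
  assumes "ppr_le n x y"
  shows "deodhar_le n x y"
proof -
  let ?r = "ppr_order n \<inter> {(x, y). deodhar_le n x y}"
  have po: "partial_order_on (rook_monoid n) (ppr_order n)"
    by (rule ppr_order_partial_order)
  have "le_c a c" if "le_c a b" "le_c b c" for a b c
    using that order_trans unfolding le_c_def by metis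
  then have "trans {(x, y). deodhar_le n x y}"
    unfolding trans_def deodhar_le_def by blast
  then have "trans ?r" "antisym ?r"
    using po unfolding partial_order_on_def preorder_on_def
    by (blast intro: trans_Int antisym_subset)+
  then have "partial_order_on (rook_monoid n) ?r"
    using po unfolding partial_order_on_def preorder_on_def
    by (auto simp: refl_on_def deodhar_le_iff_rank)
  moreover have "ppr_gen n \<subseteq> ?r"
  proof
    fix e assume e: "e \<in> ppr_gen n"
    then obtain x y where xy: "e = (x, y)" "x \<in> rook_monoid n" "y \<in> rook_monoid n"
      and gen: "ppr_increase (one_line x) (one_line y) \<or> ppr_swap (one_line x) (one_line y)"
      by (auto simp: ppr_gen_def)
    have "deodhar_le n x y"
      unfolding deodhar_le_iff_rank[OF xy(2,3)]
      using gen ppr_increase_rank_le ppr_swap_rank_le length_one_line[OF xy(2)] by metis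
    then show "e \<in> ?r" using e xy(1) ppr_gen_subset by blast
  qed
  ultimately have "ppr_order n \<subseteq> ?r"
    unfolding ppr_order_def[of n] by blast
  then show ?thesis using assms by (auto simp: ppr_le_def)
qed

theorem theorem1p8:
  fixes n :: nat
  assumes "n \<ge> 1"
  shows "\<forall>x\<in>rook_monoid n. \<forall>y\<in>rook_monoid n. deodhar_le n x y \<longleftrightarrow> ppr_le n x y"
proof (intro ballI iffI)
  fix x y assume x: "x \<in> rook_monoid n" and y: "y \<in> rook_monoid n"
  assume "deodhar_le n x y"
  then have "ppr_le n (matrix_of n (one_line x)) (matrix_of n (one_line y))"
    using rook_word_one_line[OF x] rook_word_one_line[OF y] deodhar_le_iff_rank[OF x y]
    by (intro rank_le_imp_ppr_le) auto
  then show "ppr_le n x y" by (simp add: matrix_of_one_line x y)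
qed (rule ppr_le_imp_deodhar_le)

end
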